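(* Let $q\ge1$ be an integer and $\beta$ a constant. Let $G$ be a finite graph with an interaction energy $J_e$ on each edge $e$ and a complex value $z_i$ at each vertex $v_i$, and let $Z(G)=\sum_\sigma\mathrm{e}^{-\beta h(\sigma)}$ with \[h(\sigma)=-\sum_{e=\{v_i,v_j\}\in E(G)}J_e\,\delta(\sigma_i,\sigma_j)-\sum_{v_i\in V(G)}z_i\,\delta(1,\sigma_i).\] Then \[Z(G)=\boldsymbol{V}\Big(G,\omega;\{X_z\}_{z\in\mathbb{C}},\{\mathrm{e}^{\beta J_e}-1\}_{e\in E(G)}\Big),\] where the vertex weights are $\omega(v_i)=z_i$ and $X_z=\mathrm{e}^{\beta z}+q-1$.
   Context: Graphs are finite, loops and multiple edges allowed. A state is a map $\sigma:V(G)\to\{1,\dots,q\}$, $\sigma_i=\sigma(v_i)$; $Z$ sums over all states; $\delta$ is the Kronecker delta. The $\boldsymbol{V}$-polynomial here has vertex weights in the additive semigroup $S=\mathbb{C}$, variables $\{x_k\}_{k\in S}$ and edge weights $\gamma_e$, defined recursively by: for a non-loop edge $e$, $\boldsymbol{V}(G)=\boldsymbol{V}(G-e)+\gamma_e\boldsymbol{V}(G/e)$; for a loop $e$, $\boldsymbol{V}(G)=(\gamma_e+1)\boldsymbol{V}(G-e)$; for $m$ isolated vertices of weights $\omega_1,\dots,\omega_m$, $\boldsymbol{V}=\prod x_{\omega_i}$. Here $G-e$ deletes $e$, weights unchanged; $G/e$ contracts a non-loop edge $e=\{v_a,v_b\}$, the merged vertex receiving weight $\omega(v_a)+\omega(v_b)$.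 The equation means $x_z$ is replaced by $X_z$ and $\gamma_e$ by $\mathrm{e}^{\beta J_e}-1$. *)

theory Defs
  imports Complex_Main "HOL-Library.Uprod" "HOL-Library.Poly_Mapping" "HOL-Library.FuncSet"
begin

text \<open>
  Loops and multiple edges are allowed: edges are named, and the ends of an edge form an unordered
  pair of vertices, a loop being an edge whose pair of ends is diagonal.
\<close>

record ('v, 'e) multigraph =
  verts :: "'v set"
  edges :: "'e set"
  ends :: "'e \<Rightarrow> 'v uprod"

definition finite_multigraph :: "('v, 'e) multigraph \<Rightarrow> bool" where
  "finite_multigraph G \<longleftrightarrow> finite (verts G) \<and> finite (edges G) \<and>
     (\<forall>e \<in> edges G. set_uprod (ends G e) \<subseteq> verts G)"

definition is_loop :: "('v, 'e) multigraph \<Rightarrow> 'e \<Rightarrow> bool" where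
  "is_loop G e \<longleftrightarrow> \<not> proper_uprod (ends G e)"

definition delete_edge :: "('v, 'e) multigraph \<Rightarrow> 'e \<Rightarrow> ('v, 'e) multigraph" where
  "delete_edge G e = G\<lparr>edges := edges G - {e}\<rparr>"

text \<open>
  Contraction of an edge \<open>e\<close> with distinct ends \<open>a\<close> and \<open>b\<close>: the merged vertex is called \<open>a\<close>.
  Edges other than \<open>e\<close> joining \<open>a\<close> and \<open>b\<close> become loops.
\<close>

definition merge :: "'v \<Rightarrow> 'v \<Rightarrow> 'v \<Rightarrow> 'v" where
  "merge a b v = (if v = b then a else v)"

definition contract_edge ::
    "('v, 'e) multigraph \<Rightarrow> 'e \<Rightarrow> 'v \<Rightarrow> 'v \<Rightarrow> ('v, 'e) multigraph" where
  "contract_edge G e a b =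
     \<lparr>verts = verts G - {b}, edges = edges G - {e}, ends = (\<lambda>f. map_uprod (merge a b) (ends G f))\<rparr>"

definition contract_weight :: "('v \<Rightarrow> 'k::plus) \<Rightarrow> 'v \<Rightarrow> 'v \<Rightarrow> 'v \<Rightarrow> 'k" where
  "contract_weight \<omega> a b = \<omega>(a := \<omega> a + \<omega> b)"


text \<open>
  Polynomials with integer coefficients in commuting indeterminates from \<open>'i\<close>; the ring operations
  are those of \<^theory>\<open>HOL-Library.Poly_Mapping\<close>.
\<close>

type_synonym 'i int_mpoly = "('i \<Rightarrow>\<^sub>0 nat) \<Rightarrow>\<^sub>0 int"

definition indet :: "'i \<Rightarrow> 'i int_mpoly" where
  "indet i = Poly_Mapping.single (Poly_Mapping.single i 1) 1"

definition eval_mpoly :: "('i \<Rightarrow> 'r::comm_ring_1) \<Rightarrow> 'i int_mpoly \<Rightarrow> 'r" where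
  "eval_mpoly f p =
     (\<Sum>m \<in> Poly_Mapping.keys p. of_int (Poly_Mapping.lookup p m) *
        (\<Prod>i \<in> Poly_Mapping.keys m. f i ^ Poly_Mapping.lookup m i))"

datatype ('k, 'e) V_indet = Weight_Var 'k | Edge_Var 'e

abbreviation x_var :: "'k \<Rightarrow> ('k, 'e) V_indet int_mpoly" where
  "x_var k \<equiv> indet (Weight_Var k)"

abbreviation gamma_var :: "'e \<Rightarrow> ('k, 'e) V_indet int_mpoly" where
  "gamma_var e \<equiv> indet (Edge_Var e)"

text \<open>
  \<open>V_rec G \<omega> p\<close>: the polynomial \<open>p\<close> is obtained from \<open>(G, \<omega>)\<close> by some complete run of the
  deletion-contraction recursion. Edges may be processed in any order; in the contraction rule
  either end may provide the name of the merged vertex, as \<^term>\<open>Upair a b = Upair b a\<close>.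
\<close>

inductive V_rec ::
    "('v, 'e) multigraph \<Rightarrow> ('v \<Rightarrow> 'k::comm_monoid_add) \<Rightarrow> ('k, 'e) V_indet int_mpoly \<Rightarrow> bool"
where
  isolated: "edges G = {} \<Longrightarrow> V_rec G \<omega> (\<Prod>v \<in> verts G. x_var (\<omega> v))"
| loop: "e \<in> edges G \<Longrightarrow> is_loop G e \<Longrightarrow> V_rec (delete_edge G e) \<omega> p \<Longrightarrow>
    V_rec G \<omega> ((gamma_var e + 1) * p)"
| nonloop: "e \<in> edges G \<Longrightarrow> ends G e = Upair a b \<Longrightarrow> a \<noteq> b \<Longrightarrow>
    V_rec (delete_edge G e) \<omega> p \<Longrightarrow>
    V_rec (contract_edge G e a b) (contract_weight \<omega> a b) r \<Longrightarrow>
    V_rec G \<omega> (p + gamma_var e * r)"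

text \<open>\<open>V_rec_ex1\<close> below shows that the description is proper for every finite multigraph.\<close>

definition V_poly ::
    "('v, 'e) multigraph \<Rightarrow> ('v \<Rightarrow> 'k::comm_monoid_add) \<Rightarrow> ('k, 'e) V_indet int_mpoly" where
  "V_poly G \<omega> = (THE p. V_rec G \<omega> p)"

text \<open>The value of the polynomial when each \<open>x\<^sub>k\<close> is replaced by \<open>X k\<close> and each \<open>\<gamma>\<^sub>e\<close> by \<open>g e\<close>.\<close>

definition V_value ::
    "('v, 'e) multigraph \<Rightarrow> ('v \<Rightarrow> 'k::comm_monoid_add) \<Rightarrow> ('k \<Rightarrow> 'r::comm_ring_1) \<Rightarrow>
     ('e \<Rightarrow> 'r) \<Rightarrow> 'r" where
  "V_value G \<omega> X g = eval_mpoly (case_V_indet X g) (V_poly G \<omega>)"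


subsection \<open>The recursion is well defined\<close>

lemma finite_multigraph_delete_edge:
  "finite_multigraph G \<Longrightarrow> finite_multigraph (delete_edge G e)"
  by (auto simp: finite_multigraph_def delete_edge_def)

lemma finite_multigraph_contract_edge:
  assumes "finite_multigraph G" "e \<in> edges G" "ends G e = Upair a b" "a \<noteq> b"
  shows "finite_multigraph (contract_edge G e a b)"
proof -
  have "set_uprod (ends G e) \<subseteq> verts G"
    using assms(1,2) by (simp add: finite_multigraph_def)
  then have a: "a \<in> verts G" using assms(3) by simp
  have "set_uprod (map_uprod (merge a b) u) \<subseteq> verts G - {b}" if "set_uprod u \<subseteq> verts G" for u
    using that a assms(4) by (cases u) (auto simp: merge_def)
  then show ?thesis
    using assms(1) by (simp add: finite_multigraph_def contract_edge_def)
qed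

lemma V_rec_ex:
  assumes "finite_multigraph G"
  shows "\<exists>p. V_rec G \<omega> p"
  using assms
proof (induction "card (edges G)" arbitrary: G \<omega> rule: less_induct)
  case less
  show ?case
  proof (cases "edges G = {}")
    case True
    then show ?thesis by (blast intro: V_rec.isolated)
  next
    case False
    then obtain e where e: "e \<in> edges G" by blast
    have card: "card (edges G - {e}) < card (edges G)"
      using less.prems e by (intro psubset_card_mono) (auto simp: finite_multigraph_def)
    have "\<exists>p. V_rec (delete_edge G e) \<omega> p"
      using less.prems card
      by (intro less.hyps finite_multigraph_delete_edge) (simp_all add: delete_edge_def)
    then obtain p where p: "V_rec (delete_edge G e) \<omega> p" ..
    obtain a b where ab: "ends G e = Upair a b" by (cases "ends G e")
    show ?thesis
    proof (cases "a = b")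
      case True
      then have "is_loop G e" using ab by (simp add: is_loop_def)
      then show ?thesis using e p by (blast intro: V_rec.loop)
    next
      case False
      have "\<exists>r. V_rec (contract_edge G e a b) (contract_weight \<omega> a b) r"
        using less.prems card e ab False
        by (intro less.hyps finite_multigraph_contract_edge) (simp_all add: contract_edge_def)
      then show ?thesis using e ab False p by (blast intro: V_rec.nonloop)
    qed
  qed
qed

text \<open>
  Uniqueness: every run of the recursion computes the expansion over spanning subgraphs.
\<close>

definition adj :: "('e \<Rightarrow> 'v uprod) \<Rightarrow> 'e set \<Rightarrow> ('v \<times> 'v) set" where
  "adj d A = {(u, v). \<exists>e \<in> A. d e = Upair u v}"

definition component_of :: "'v set \<Rightarrow> ('e \<Rightarrow> 'v uprod) \<Rightarrow> 'e set \<Rightarrow> 'v \<Rightarrow> 'v set" where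
  "component_of U d A u = {v \<in> U. (u, v) \<in> (adj d A)\<^sup>*}"

definition component_term ::
    "'v set \<Rightarrow> ('e \<Rightarrow> 'v uprod) \<Rightarrow> ('v \<Rightarrow> 'k::comm_monoid_add) \<Rightarrow> 'e set \<Rightarrow> ('k, 'e) V_indet int_mpoly"
where
  "component_term U d \<omega> A = (\<Prod>C \<in> component_of U d A ` U. x_var (sum \<omega> C))"

definition subgraph_expansion ::
    "('v, 'e) multigraph \<Rightarrow> ('v \<Rightarrow> 'k::comm_monoid_add) \<Rightarrow> ('k, 'e) V_indet int_mpoly" where
  "subgraph_expansion G \<omega> =
     (\<Sum>A \<in> Pow (edges G). (\<Prod>e \<in> A. gamma_var e) * component_term (verts G) (ends G) \<omega> A)"

lemma adjI:
  assumes "e \<in> A" "d e = Upair u v"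
  shows "(u, v) \<in> adj d A" "(v, u) \<in> adj d A"
  using assms by (auto simp: adj_def intro!: bexI[of _ e])

lemma sym_adj: "sym (adj d A)"
proof (rule symI)
  fix u v assume "(u, v) \<in> adj d A"
  then obtain e where "e \<in> A" "d e = Upair u v" by (auto simp: adj_def)
  then show "(v, u) \<in> adj d A" by (rule adjI)
qed

lemma component_of_eq_iff:
  assumes "u \<in> U" "v \<in> U"
  shows "component_of U d A u = component_of U d A v \<longleftrightarrow> (u, v) \<in> (adj d A)\<^sup>*"
proof
  assume "component_of U d A u = component_of U d A v"
  then have "v \<in> component_of U d A u"
    using assms by (auto simp: component_of_def)
  then show "(u, v) \<in> (adj d A)\<^sup>*"
    by (simp add: component_of_def)
next
  assume uv: "(u, v) \<in> (adj d A)\<^sup>*"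
  then have "(v, u) \<in> (adj d A)\<^sup>*"
    by (meson sym_adj sym_rtrancl symD)
  with uv show "component_of U d A u = component_of U d A v"
    by (auto simp: component_of_def intro: rtrancl_trans)
qed

lemma component_term_empty:
  "component_term U d \<omega> {} = (\<Prod>v \<in> U. x_var (\<omega> v))"
proof -
  have "component_of U d {} ` U = (\<lambda>v. {v}) ` U"
    by (auto simp: component_of_def adj_def intro!: image_cong)
  then show ?thesis
    by (simp add: component_term_def prod.reindex inj_on_def)
qed

lemma component_term_loop:
  assumes "d e = Upair a a"
  shows "component_term U d \<omega> (insert e A) = component_term U d \<omega> A"
proof -
  have "adj d (insert e A) = insert (a, a) (adj d A)"
    using assms by (auto simp: adj_def)
  moreover have "(insert (a, a) (adj d A))\<^sup>* = (adj d A)\<^sup>*"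
    by (rule rtrancl_subset) auto
  ultimately show ?thesis
    by (simp add: component_term_def component_of_def[abs_def])
qed

lemma rtrancl_adj_contract:
  assumes "d e = Upair a b"
  shows "(merge a b u, merge a b v) \<in> (adj (\<lambda>f. map_uprod (merge a b) (d f)) A)\<^sup>* \<longleftrightarrow>
         (u, v) \<in> (adj d (insert e A))\<^sup>*"
proof
  let ?m = "merge a b" and ?d' = "\<lambda>f. map_uprod (merge a b) (d f)"
  have m: "(x, ?m x) \<in> (adj d (insert e A))\<^sup>*" "(?m x, x) \<in> (adj d (insert e A))\<^sup>*" for x
    using adjI[where A = "insert e A" and d = d, OF insertI1 assms] by (auto simp: merge_def)
  have "(x, y) \<in> (adj d (insert e A))\<^sup>*" if "(x, y) \<in> (adj ?d' A)\<^sup>*" for x y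
    using that
  proof induction
    case base
    then show ?case by simp
  next
    case (step y z)
    then obtain f where f: "f \<in> A" "?d' f = Upair y z"
      by (auto simp: adj_def)
    obtain p q where pq: "d f = Upair p q" by (cases "d f")
    have "(p, q) \<in> (adj d (insert e A))\<^sup>*" "(q, p) \<in> (adj d (insert e A))\<^sup>*"
      using adjI[where A = "insert e A" and d = d, OF insertI2[OF f(1)] pq] by auto
    then have "(?m p, ?m q) \<in> (adj d (insert e A))\<^sup>*" "(?m q, ?m p) \<in> (adj d (insert e A))\<^sup>*"
      using m by (meson rtrancl_trans)+
    moreover have "y = ?m p \<and> z = ?m q \<or> y = ?m q \<and> z = ?m p"
      using f(2) pq by auto
    ultimately show ?case
      using step.IH by (metis rtrancl_trans)
  qed
  moreover assume "(?m u, ?m v) \<in> (adj ?d' A)\<^sup>*"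
  ultimately show "(u, v) \<in> (adj d (insert e A))\<^sup>*"
    using m by (meson rtrancl_trans)
next
  let ?m = "merge a b" and ?d' = "\<lambda>f. map_uprod (merge a b) (d f)"
  assume "(u, v) \<in> (adj d (insert e A))\<^sup>*"
  then show "(?m u, ?m v) \<in> (adj ?d' A)\<^sup>*"
  proof induction
    case base
    then show ?case by simp
  next
    case (step y z)
    then obtain f where f: "f \<in> insert e A" "d f = Upair y z"
      by (auto simp: adj_def)
    show ?case
    proof (cases "f \<in> A")
      case True
      then have "(?m y, ?m z) \<in> adj ?d' A"
        using f by (force simp: adj_def)
      then show ?thesis using step.IH by (rule rtrancl_into_rtrancl[rotated])
    next
      case False
      then have "Upair y z = Upair a b" using f assms by auto
      then have "?m y = ?m z" by (auto simp: merge_def)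
      then show ?thesis using step.IH by simp
    qed
  qed
qed

lemma component_term_contract:
  assumes "d e = Upair a b" "a \<noteq> b" "a \<in> U" "b \<in> U" "finite U"
  shows "component_term (U - {b}) (\<lambda>f. map_uprod (merge a b) (d f)) (contract_weight \<omega> a b) A =
         component_term U d \<omega> (insert e A)"
proof -
  let ?m = "merge a b" and ?d' = "\<lambda>f. map_uprod (merge a b) (d f)"
  let ?c = "component_of U d (insert e A)" and ?c' = "component_of (U - {b}) ?d' A"
  have ab: "(a, b) \<in> (adj d (insert e A))\<^sup>*" "(b, a) \<in> (adj d (insert e A))\<^sup>*"
    using adjI[where A = "insert e A" and d = d, OF insertI1 assms(1)] by auto
  have c': "?c' u = ?c u - {b}" if "u \<in> U - {b}" for u
  proof -
    have "(u, v) \<in> (adj ?d' A)\<^sup>* \<longleftrightarrow> (u, v) \<in> (adj d (insert e A))\<^sup>*" if "v \<noteq> b" for v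
      using rtrancl_adj_contract[where d = d and e = e, OF assms(1), of u v A] that \<open>u \<in> U - {b}\<close>
      by (simp add: merge_def)
    then show ?thesis by (auto simp: component_of_def)
  qed
  have mem: "a \<in> C \<longleftrightarrow> b \<in> C" if "C \<in> ?c ` U" for C
    using that ab assms by (auto simp: component_of_def intro: rtrancl_trans)
  have "?c b = ?c a"
    using component_of_eq_iff[of b U a d "insert e A"] ab assms by simp
  moreover have "?c a \<in> ?c ` (U - {b})"
    using assms(2,3) by (intro imageI) simp
  moreover have "?c ` U = insert (?c b) (?c ` (U - {b}))"
    unfolding image_insert[symmetric] insert_Diff[OF assms(4)] ..
  ultimately have "?c ` U = ?c ` (U - {b})"
    by (simp add: insert_absorb)
  then have img: "?c' ` (U - {b}) = (\<lambda>C. C - {b}) ` ?c ` U"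
    using c' by (auto simp: image_image intro!: image_cong)
  have inj: "inj_on (\<lambda>C. C - {b}) (?c ` U)"
  proof (rule inj_onI)
    fix C D assume CD: "C \<in> ?c ` U" "D \<in> ?c ` U" "C - {b} = D - {b}"
    then have "b \<in> C \<longleftrightarrow> b \<in> D" using mem assms(2) by blast
    with CD(3) show "C = D" by blast
  qed
  have wt: "sum (contract_weight \<omega> a b) (C - {b}) = sum \<omega> C" if "C \<in> ?c ` U" for C
  proof -
    have fin: "finite C" using that assms(5) by (auto simp: component_of_def)
    show ?thesis
    proof (cases "a \<in> C")
      case True
      then have "b \<in> C" using mem[OF that] by simp
      have "sum (contract_weight \<omega> a b) (C - {b}) =
            (\<omega> a + \<omega> b) + sum (contract_weight \<omega> a b) (C - {b} - {a})"
        using True assms(2) fin by (subst sum.remove[of _ a]) (auto simp: contract_weight_def)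
      also have "sum (contract_weight \<omega> a b) (C - {b} - {a}) = sum \<omega> (C - {b} - {a})"
        by (rule sum.cong) (auto simp: contract_weight_def)
      also have "(\<omega> a + \<omega> b) + sum \<omega> (C - {b} - {a}) = \<omega> b + (\<omega> a + sum \<omega> (C - {b} - {a}))"
        by (simp add: ac_simps)
      also have "\<omega> a + sum \<omega> (C - {b} - {a}) = sum \<omega> (C - {b})"
        using True assms(2) fin by (subst (2) sum.remove[of _ a]) auto
      also have "\<omega> b + sum \<omega> (C - {b}) = sum \<omega> C"
        using \<open>b \<in> C\<close> fin by (subst (2) sum.remove[of _ b]) auto
      finally show ?thesis .
    next
      case False
      then have "C - {b} = C" using mem[OF that] by blast
      moreover have "sum (contract_weight \<omega> a b) C = sum \<omega> C"
        using False by (intro sum.cong refl) (auto simp: contract_weight_def)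
      ultimately show ?thesis by simp
    qed
  qed
  show ?thesis
    unfolding component_term_def img prod.reindex[OF inj] by (rule prod.cong) (simp_all add: wt)
qed

lemma sum_Pow_insert:
  fixes f :: "'e set \<Rightarrow> 'r::comm_monoid_add"
  assumes "finite E" "e \<in> E"
  shows "sum f (Pow E) = (\<Sum>A \<in> Pow (E - {e}). f A) + (\<Sum>A \<in> Pow (E - {e}). f (insert e A))"
proof -
  have "Pow E = Pow (E - {e}) \<union> insert e ` Pow (E - {e})"
    using assms(2) by (metis Pow_insert insert_Diff)
  moreover have "Pow (E - {e}) \<inter> insert e ` Pow (E - {e}) = {}" by auto
  moreover have "inj_on (insert e) (Pow (E - {e}))"
    by (auto simp: inj_on_def)
  ultimately show ?thesis
    using assms(1) by (simp add: sum.union_disjoint sum.reindex)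
qed

lemma V_rec_imp_subgraph_expansion:
  assumes "V_rec G \<omega> p" "finite_multigraph G"
  shows "p = subgraph_expansion G \<omega>"
  using assms
proof (induction rule: V_rec.induct)
  case (isolated G \<omega>)
  then show ?case by (simp add: subgraph_expansion_def component_term_empty)
next
  case (loop e G \<omega> p)
  obtain a where a: "ends G e = Upair a a"
    using loop.hyps by (cases "ends G e") (auto simp: is_loop_def)
  have fin: "finite (edges G)" using loop.prems by (simp add: finite_multigraph_def)
  have p: "p = (\<Sum>A \<in> Pow (edges G - {e}).
      (\<Prod>f \<in> A. gamma_var f) * component_term (verts G) (ends G) \<omega> A)"
    using loop.IH loop.prems
    by (simp add: finite_multigraph_delete_edge subgraph_expansion_def) (simp add: delete_edge_def)
  have "(\<Prod>f \<in> insert e A. gamma_var f) * component_term (verts G) (ends G) \<omega> (insert e A) =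
      gamma_var e * ((\<Prod>f \<in> A. gamma_var f) * component_term (verts G) (ends G) \<omega> A)"
    if "A \<in> Pow (edges G - {e})" for A
  proof -
    have "finite A" "e \<notin> A" using that fin by (auto intro: finite_subset)
    then show ?thesis by (simp add: component_term_loop[where d = "ends G" and e = e, OF a] mult.assoc)
  qed
  then show ?case
    unfolding subgraph_expansion_def sum_Pow_insert[OF fin loop.hyps(1)]
    by (simp add: p sum_distrib_left distrib_right add.commute sum.distrib)
next
  case (nonloop e G a b \<omega> p r)
  have fin: "finite (edges G)" "finite (verts G)"
    using nonloop.prems by (simp_all add: finite_multigraph_def)
  have ab: "a \<in> verts G" "b \<in> verts G"
    using nonloop.prems nonloop.hyps(1,2) by (force simp: finite_multigraph_def)+
  have p: "p = (\<Sum>A \<in> Pow (edges G - {e}).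
      (\<Prod>f \<in> A. gamma_var f) * component_term (verts G) (ends G) \<omega> A)"
    using nonloop.IH(1) nonloop.prems
    by (simp add: finite_multigraph_delete_edge subgraph_expansion_def) (simp add: delete_edge_def)
  have r: "r = (\<Sum>A \<in> Pow (edges G - {e}).
      (\<Prod>f \<in> A. gamma_var f) * component_term (verts G) (ends G) \<omega> (insert e A))"
    using nonloop.IH(2) nonloop.prems nonloop.hyps(1,2,3)
    by (simp add: finite_multigraph_contract_edge subgraph_expansion_def)
       (simp add: contract_edge_def component_term_contract ab fin)
  have "(\<Prod>f \<in> insert e A. gamma_var f) * component_term (verts G) (ends G) \<omega> (insert e A) =
      gamma_var e * ((\<Prod>f \<in> A. gamma_var f) * component_term (verts G) (ends G) \<omega> (insert e A))"
    if "A \<in> Pow (edges G - {e})" for A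
  proof -
    have "finite A" "e \<notin> A" using that fin by (auto intro: finite_subset)
    then show ?thesis by (simp add: mult.assoc)
  qed
  then show ?case
    unfolding subgraph_expansion_def sum_Pow_insert[OF fin(1) nonloop.hyps(1)]
    by (simp add: p r sum_distrib_left)
qed

theorem V_rec_ex1:
  assumes "finite_multigraph G"
  shows "\<exists>!p. V_rec G \<omega> p"
proof (rule ex_ex1I)
  show "\<exists>p. V_rec G \<omega> p" using assms by (rule V_rec_ex)
  show "p = r" if "V_rec G \<omega> p" "V_rec G \<omega> r" for p r
    using V_rec_imp_subgraph_expansion[OF that(1) assms]
      V_rec_imp_subgraph_expansion[OF that(2) assms] by simp
qed

corollary V_rec_V_poly:
  "finite_multigraph G \<Longrightarrow> V_rec G \<omega> (V_poly G \<omega>)"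
  unfolding V_poly_def by (rule theI', rule V_rec_ex1)

corollary V_poly_eqI:
  "finite_multigraph G \<Longrightarrow> V_rec G \<omega> p \<Longrightarrow> V_poly G \<omega> = p"
  unfolding V_poly_def by (rule the1_equality, rule V_rec_ex1)

corollary V_poly_isolated:
  "finite_multigraph G \<Longrightarrow> edges G = {} \<Longrightarrow> V_poly G \<omega> = (\<Prod>v \<in> verts G. x_var (\<omega> v))"
  by (rule V_poly_eqI, assumption, rule V_rec.isolated)

corollary V_poly_loop:
  assumes "finite_multigraph G" "e \<in> edges G" "is_loop G e"
  shows "V_poly G \<omega> = (gamma_var e + 1) * V_poly (delete_edge G e) \<omega>"
  by (rule V_poly_eqI[OF assms(1)], rule V_rec.loop[OF assms(2,3)], rule V_rec_V_poly,
      rule finite_multigraph_delete_edge[OF assms(1)])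

corollary V_poly_nonloop:
  assumes "finite_multigraph G" "e \<in> edges G" "ends G e = Upair a b" "a \<noteq> b"
  shows "V_poly G \<omega> = V_poly (delete_edge G e) \<omega> +
    gamma_var e * V_poly (contract_edge G e a b) (contract_weight \<omega> a b)"
  by (rule V_poly_eqI[OF assms(1)], rule V_rec.nonloop[OF assms(2-4)]; rule V_rec_V_poly)
    (rule finite_multigraph_delete_edge[OF assms(1)], rule finite_multigraph_contract_edge[OF assms])


subsection \<open>The Potts model with a complex value at each vertex\<close>

definition kronecker :: "'a \<Rightarrow> 'a \<Rightarrow> complex" where
  "kronecker i j = (if i = j then 1 else 0)"

text \<open>Functions are undefined outside \<open>verts G\<close>, so that each state is counted once.\<close>

definition states :: "nat \<Rightarrow> ('v, 'e) multigraph \<Rightarrow> ('v \<Rightarrow> nat) set" where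
  "states q G = verts G \<rightarrow>\<^sub>E {1..q}"

text \<open>
  The map sending the unordered pair of \<open>v\<^sub>i\<close> and \<open>v\<^sub>j\<close> to \<open>\<delta>(\<sigma>\<^sub>i, \<sigma>\<^sub>j)\<close>.
\<close>

lift_definition kronecker_ends :: "('v \<Rightarrow> 's) \<Rightarrow> ('v, complex) commute" is
  "\<lambda>\<sigma> i j. kronecker (\<sigma> i) (\<sigma> j)"
  by (simp add: kronecker_def eq_commute)

lemma case_uprod_kronecker_ends:
  "case_uprod (kronecker_ends \<sigma>) (Upair i j) = kronecker (\<sigma> i) (\<sigma> j)"
  by (simp add: kronecker_ends.rep_eq)

definition hamiltonian ::
    "('v, 'e) multigraph \<Rightarrow> ('e \<Rightarrow> complex) \<Rightarrow> ('v \<Rightarrow> complex) \<Rightarrow> ('v \<Rightarrow> nat) \<Rightarrow> complex" where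
  "hamiltonian G J z \<sigma> =
     - (\<Sum>e \<in> edges G. J e * case_uprod (kronecker_ends \<sigma>) (ends G e))
     - (\<Sum>v \<in> verts G. z v * kronecker 1 (\<sigma> v))"

definition partition_function ::
    "nat \<Rightarrow> complex \<Rightarrow> ('v, 'e) multigraph \<Rightarrow> ('e \<Rightarrow> complex) \<Rightarrow> ('v \<Rightarrow> complex) \<Rightarrow> complex" where
  "partition_function q \<beta> G J z = (\<Sum>\<sigma> \<in> states q G. exp (- \<beta> * hamiltonian G J z \<sigma>))"

end

theory Submission
  imports Defs
begin

text \<open>
  Grouping the states by whether the two ends of an edge carry the same spin shows that the
  partition function, as a function of the weighted graph, satisfies the deletion-contraction
  recursion of the \<open>V\<close>-polynomial: since \<open>exp (\<beta> J\<^sub>e \<delta>) = 1 + (exp (\<beta> J\<^sub>e) - 1) \<delta>\<close> for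
  \<open>\<delta> \<in> {0, 1}\<close>, the term \<open>1\<close> accounts for the deletion of \<open>e\<close>, and the states that agree on the ends
  of \<open>e\<close> are the states of the contraction.
\<close>

section \<open>Evaluation of integer polynomials as a ring homomorphism\<close>

definition eval_monom :: "('i \<Rightarrow> 'r::comm_ring_1) \<Rightarrow> ('i \<Rightarrow>\<^sub>0 nat) \<Rightarrow> 'r" where
  "eval_monom f m = (\<Prod>i \<in> Poly_Mapping.keys m. f i ^ Poly_Mapping.lookup m i)"

text \<open>Indices outside the support have exponent 0 and contribute the factor 1. Monomials with
  different supports can thus be compared over a common index set.\<close>

lemma eval_monom_superset:
  assumes "finite I" "Poly_Mapping.keys m \<subseteq> I"
  shows "eval_monom f m = (\<Prod>i \<in> I. f i ^ Poly_Mapping.lookup m i)"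
  unfolding eval_monom_def
  by (rule prod.mono_neutral_left) (use assms in \<open>auto simp: in_keys_iff\<close>)

lemma eval_monom_add: "eval_monom f (m + n) = eval_monom f m * eval_monom f n"
proof -
  let ?I = "Poly_Mapping.keys m \<union> Poly_Mapping.keys n"
  have "eval_monom f (m + n) = (\<Prod>i \<in> ?I. f i ^ Poly_Mapping.lookup (m + n) i)"
    by (rule eval_monom_superset) (simp_all add: keys_add)
  also have "\<dots> = eval_monom f m * eval_monom f n"
    by (simp add: eval_monom_superset[where I = ?I] lookup_add power_add prod.distrib)
  finally show ?thesis .
qed

text \<open>Coefficients outside the support vanish. A common index set is needed for sums, since
  cancellation can make the support of \<open>p + r\<close> smaller than the union of the two
  supports.\<close>

lemma eval_mpoly_superset:
  assumes "finite M" "Poly_Mapping.keys p \<subseteq> M"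
  shows "eval_mpoly f p = (\<Sum>m \<in> M. of_int (Poly_Mapping.lookup p m) * eval_monom f m)"
  unfolding eval_mpoly_def eval_monom_def
  by (rule sum.mono_neutral_left) (use assms in \<open>auto simp: in_keys_iff\<close>)

lemma eval_mpoly_add: "eval_mpoly f (p + r) = eval_mpoly f p + eval_mpoly f r"
proof -
  let ?M = "Poly_Mapping.keys p \<union> Poly_Mapping.keys r"
  have "eval_mpoly f (p + r) =
      (\<Sum>m \<in> ?M. of_int (Poly_Mapping.lookup (p + r) m) * eval_monom f m)"
    by (rule eval_mpoly_superset) (simp_all add: keys_add)
  also have "\<dots> = eval_mpoly f p + eval_mpoly f r"
    by (simp add: eval_mpoly_superset[where M = ?M] lookup_add distrib_right sum.distrib)
  finally show ?thesis .
qed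

lemma eval_mpoly_single:
  "eval_mpoly f (Poly_Mapping.single m c) = of_int c * eval_monom f m"
  by (subst eval_mpoly_superset[where M = "{m}"]) simp_all

lemma eval_mpoly_zero: "eval_mpoly f 0 = 0"
  by (simp add: eval_mpoly_def)

lemma eval_mpoly_one: "eval_mpoly f 1 = 1"
  by (simp add: single_one[symmetric] eval_mpoly_single eval_monom_def del: single_one)

lemma eval_mpoly_indet: "eval_mpoly f (indet i) = f i"
  by (simp add: indet_def eval_mpoly_single eval_monom_def)

text \<open>Builds a polynomial by adding one term at a time, so that additive statements reduce to
  single terms.\<close>

lemma int_mpoly_induct [case_names zero add_single]:
  fixes p :: "'i int_mpoly"
  assumes "P 0" "\<And>p m c. P p \<Longrightarrow> P (p + Poly_Mapping.single m c)"
  shows "P p"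
proof (induction p rule: update_induct)
  case const
  show ?case by (rule assms(1))
next
  case (update p m c)
  \<comment> \<open>The monomial \<open>m\<close> is fresh, so its old coefficient is 0 and
    overwriting it amounts to adding.\<close>
  have "Poly_Mapping.update m c p = p + Poly_Mapping.single m c"
    using update(1) by (intro poly_mapping_eqI)
      (auto simp: update.rep_eq lookup_add lookup_single in_keys_iff when_def)
  then show ?case using assms(2)[OF update(3)] by simp
qed

text \<open>Both sides are additive in \<open>p\<close> and in \<open>r\<close>. Two nested
  inductions therefore reduce the claim to a product of two single terms, where exponents
  add.\<close>

lemma eval_mpoly_mult: "eval_mpoly f (p * r) = eval_mpoly f p * eval_mpoly f r"
proof (induction p rule: int_mpoly_induct)
  case zero
  show ?case by (simp add: eval_mpoly_zero)
next
  case (add_single p m c)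
  have "eval_mpoly f (Poly_Mapping.single m c * r) =
      eval_mpoly f (Poly_Mapping.single m c) * eval_mpoly f r"
    by (induction r rule: int_mpoly_induct)
      (simp_all add: eval_mpoly_zero eval_mpoly_add eval_mpoly_single mult_single eval_monom_add
        distrib_left mult_ac)
  with add_single show ?case
    by (simp add: distrib_right eval_mpoly_add)
qed

lemma eval_mpoly_prod: "eval_mpoly f (prod h A) = (\<Prod>a \<in> A. eval_mpoly f (h a))"
  by (induction A rule: infinite_finite_induct) (simp_all add: eval_mpoly_one eval_mpoly_mult)

section \<open>Boltzmann weights and the recursion for the partition function\<close>

definition boltzmann ::
    "complex \<Rightarrow> ('v, 'e) multigraph \<Rightarrow> ('e \<Rightarrow> complex) \<Rightarrow> ('v \<Rightarrow> complex) \<Rightarrow> ('v \<Rightarrow> nat) \<Rightarrow> complex"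
where
  "boltzmann \<beta> G J z \<sigma> =
     (\<Prod>e \<in> edges G. exp (\<beta> * (J e * case_uprod (kronecker_ends \<sigma>) (ends G e)))) *
     (\<Prod>v \<in> verts G. exp (\<beta> * (z v * kronecker 1 (\<sigma> v))))"

text \<open>The exponential turns the finite sums in the Hamiltonian into products, from which the
  factor of a single edge or vertex can be split off.\<close>

lemma partition_function_eq_boltzmann:
  assumes "finite_multigraph G"
  shows "partition_function q \<beta> G J z = (\<Sum>\<sigma> \<in> states q G. boltzmann \<beta> G J z \<sigma>)"
proof -
  have "exp (- \<beta> * hamiltonian G J z \<sigma>) = boltzmann \<beta> G J z \<sigma>" for \<sigma>
    using assms
    by (simp add: hamiltonian_def boltzmann_def finite_multigraph_def exp_sum[symmetric]
      exp_add[symmetric] sum_distrib_left[symmetric] algebra_simps)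
  then show ?thesis by (simp add: partition_function_def)
qed

text \<open>Without edges the spins at different vertices are independent, so the sum over states
  factors into one sum over spins per vertex.\<close>

lemma partition_function_isolated:
  assumes "q \<ge> 1" "finite_multigraph G" "edges G = {}"
  shows "partition_function q \<beta> G J z = (\<Prod>v \<in> verts G. exp (\<beta> * z v) + of_nat q - 1)"
proof -
  have fin: "finite (verts G)" using assms(2) by (simp add: finite_multigraph_def)
  \<comment> \<open>This is the origin of X_z: spin 1 contributes \<open>exp (\<beta> * c)\<close>,
    each of the other q - 1 spins contributes 1. The bound \<open>q \<ge> 1\<close> puts 1 in the
    range and makes the natural-number difference exact.\<close>
  have spin: "(\<Sum>s \<in> {1..q}. exp (\<beta> * (c * kronecker 1 s))) = exp (\<beta> * c) + of_nat q - 1" for c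
  proof -
    have "(\<Sum>s \<in> {1..q}. exp (\<beta> * (c * kronecker 1 s))) =
        exp (\<beta> * c) + (\<Sum>s \<in> {1..q} - {1}. exp (\<beta> * (c * kronecker 1 s)))"
      using assms(1) by (subst sum.remove[of _ 1]) (simp_all add: kronecker_def)
    also have "(\<Sum>s \<in> {1..q} - {1}. exp (\<beta> * (c * kronecker 1 s))) = (\<Sum>s \<in> {1..q} - {1}. 1)"
      by (rule sum.cong) (auto simp: kronecker_def)
    finally show ?thesis using assms(1) by (simp add: of_nat_diff)
  qed
  have "partition_function q \<beta> G J z =
      (\<Sum>\<sigma> \<in> verts G \<rightarrow>\<^sub>E {1..q}. \<Prod>v \<in> verts G. exp (\<beta> * (z v * kronecker 1 (\<sigma> v))))"
    by (simp add: partition_function_eq_boltzmann assms states_def boltzmann_def)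
  also have "\<dots> = (\<Prod>v \<in> verts G. \<Sum>s \<in> {1..q}. exp (\<beta> * (z v * kronecker 1 s)))"
    by (rule prod_sum_PiE[symmetric]) (simp_all add: fin)
  finally show ?thesis by (simp only: spin)
qed

lemma boltzmann_delete_edge:
  assumes "finite_multigraph G" "e \<in> edges G"
  shows "boltzmann \<beta> G J z \<sigma> =
    exp (\<beta> * (J e * case_uprod (kronecker_ends \<sigma>) (ends G e))) * boltzmann \<beta> (delete_edge G e) J z \<sigma>"
  using assms by (simp add: boltzmann_def delete_edge_def finite_multigraph_def prod.remove)

lemma states_delete_edge: "states q (delete_edge G e) = states q G"
  by (simp add: states_def delete_edge_def)

text \<open>The two ends of a loop always carry the same spin, so its factor is the same in every
  state.\<close>

lemma partition_function_loop:
  assumes "finite_multigraph G" "e \<in> edges G" "is_loop G e"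
  shows "partition_function q \<beta> G J z =
    exp (\<beta> * J e) * partition_function q \<beta> (delete_edge G e) J z"
proof -
  obtain a where "ends G e = Upair a a"
    using assms(3) by (cases "ends G e") (auto simp: is_loop_def)
  then have "case_uprod (kronecker_ends \<sigma>) (ends G e) = 1" for \<sigma> :: "'a \<Rightarrow> nat"
    by (simp only: case_uprod_kronecker_ends) (simp add: kronecker_def)
  then show ?thesis
    using assms(1,2)
    by (simp add: partition_function_eq_boltzmann finite_multigraph_delete_edge states_delete_edge
      boltzmann_delete_edge sum_distrib_left)
qed

text \<open>Pulling a state back along \<open>merge a b\<close> gives the removed vertex
  \<open>b\<close> the spin of \<open>a\<close>.\<close>

lemma bij_betw_states_contract_edge:
  assumes "a \<in> verts G" "b \<in> verts G" "a \<noteq> b"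
  shows "bij_betw (\<lambda>\<tau>. \<tau> \<circ> merge a b) (states q (contract_edge G e a b))
    {\<sigma> \<in> states q G. \<sigma> a = \<sigma> b}"
\<comment> \<open>The inverse forgets the spin at \<open>b\<close>. The value there must be
  \<open>undefined\<close>, because \<open>b\<close> is no vertex of the contraction and states are
  extensional.\<close>
proof (rule bij_betw_byWitness[where f' = "\<lambda>\<sigma>. \<sigma>(b := undefined)"])
  show "\<forall>\<tau> \<in> states q (contract_edge G e a b). (\<tau> \<circ> merge a b)(b := undefined) = \<tau>"
    by (auto simp: states_def contract_edge_def merge_def fun_eq_iff PiE_def extensional_def)
  show "\<forall>\<sigma> \<in> {\<sigma> \<in> states q G. \<sigma> a = \<sigma> b}. \<sigma>(b := undefined) \<circ> merge a b = \<sigma>"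
    using assms(3) by (auto simp: merge_def fun_eq_iff)
  show "(\<lambda>\<tau>. \<tau> \<circ> merge a b) ` states q (contract_edge G e a b) \<subseteq> {\<sigma> \<in> states q G. \<sigma> a = \<sigma> b}"
    using assms
    by (auto simp: states_def contract_edge_def merge_def PiE_def Pi_def extensional_def)
  show "(\<lambda>\<sigma>. \<sigma>(b := undefined)) ` {\<sigma> \<in> states q G. \<sigma> a = \<sigma> b} \<subseteq> states q (contract_edge G e a b)"
    by (auto simp: states_def contract_edge_def PiE_def Pi_def extensional_def)
qed

text \<open>Adding the weights of \<open>a\<close> and \<open>b\<close> multiplies their vertex
  factors, and \<open>\<tau> \<circ> merge a b\<close> has the same spin at both. The edge
  \<open>e\<close> is absent from the contraction, hence the comparison with the deletion.\<close>

lemma boltzmann_contract_edge: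
  assumes "finite (verts G)" "a \<in> verts G" "b \<in> verts G" "a \<noteq> b"
  shows "boltzmann \<beta> (contract_edge G e a b) J (contract_weight z a b) \<tau> =
    boltzmann \<beta> (delete_edge G e) J z (\<tau> \<circ> merge a b)"
proof -
  \<comment> \<open>Renaming the ends of an edge or renaming inside the state yields the same pair
    of spins. This also covers edges parallel to \<open>e\<close>, which become loops.\<close>
  have ends: "case_uprod (kronecker_ends \<tau>) (map_uprod (merge a b) u) =
      case_uprod (kronecker_ends (\<tau> \<circ> merge a b)) u" for u
    by (cases u) (simp add: kronecker_ends.rep_eq)
  let ?R = "verts G - {b} - {a}"
  let ?w = "\<lambda>v. exp (\<beta> * (z v * kronecker 1 ((\<tau> \<circ> merge a b) v)))"
  have rest: "(\<Prod>v \<in> ?R. exp (\<beta> * (contract_weight z a b v * kronecker 1 (\<tau> v)))) = prod ?w ?R"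
    by (rule prod.cong) (auto simp: contract_weight_def merge_def)
  have "(\<Prod>v \<in> verts G - {b}. exp (\<beta> * (contract_weight z a b v * kronecker 1 (\<tau> v)))) =
      exp (\<beta> * ((z a + z b) * kronecker 1 (\<tau> a))) * prod ?w ?R"
    using assms by (subst prod.remove[of _ a]) (simp_all only: rest, simp_all add: contract_weight_def)
  also have "\<dots> = ?w b * (?w a * prod ?w ?R)"
    using assms(4) by (simp add: merge_def exp_add algebra_simps)
  also have "\<dots> = prod ?w (verts G)"
    using assms by (subst (2) prod.remove[of _ b], simp, simp)
      (subst (2) prod.remove[of _ a], simp_all)
  finally show ?thesis
    by (simp add: boltzmann_def contract_edge_def delete_edge_def ends)
qed

lemma partition_function_nonloop:
  assumes "finite_multigraph G" "e \<in> edges G" "ends G e = Upair a b" "a \<noteq> b"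
  shows "partition_function q \<beta> G J z = partition_function q \<beta> (delete_edge G e) J z +
    (exp (\<beta> * J e) - 1) * partition_function q \<beta> (contract_edge G e a b) J (contract_weight z a b)"
proof -
  let ?W = "boltzmann \<beta> (delete_edge G e) J z" and ?S = "{\<sigma> \<in> states q G. \<sigma> a = \<sigma> b}"
  have fin: "finite (verts G)" "finite (states q G)"
    using assms(1) by (auto simp: finite_multigraph_def states_def intro!: finite_PiE)
  have ab: "a \<in> verts G" "b \<in> verts G"
    using assms(1-3) by (force simp: finite_multigraph_def)+
  \<comment> \<open>Deletion and contraction are separated state by state: the second summand
    survives only where the ends of \<open>e\<close> agree.\<close>
  have "boltzmann \<beta> G J z \<sigma> = ?W \<sigma> + (exp (\<beta> * J e) - 1) * (if \<sigma> a = \<sigma> b then ?W \<sigma> else 0)" for \<sigma>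
    by (simp add: boltzmann_delete_edge[OF assms(1,2)] assms(3) kronecker_ends.rep_eq kronecker_def
      algebra_simps)
  then have "partition_function q \<beta> G J z =
      sum ?W (states q G) + (exp (\<beta> * J e) - 1) * sum ?W ?S"
    using fin
    by (simp add: partition_function_eq_boltzmann[OF assms(1)] sum.distrib sum_distrib_left[symmetric]
      sum.inter_filter)
  also have "sum ?W ?S = (\<Sum>\<tau> \<in> states q (contract_edge G e a b). ?W (\<tau> \<circ> merge a b))"
    by (rule sum.reindex_bij_betw[symmetric], rule bij_betw_states_contract_edge) (fact ab assms(4))+
  finally show ?thesis
    using boltzmann_contract_edge[OF fin(1) ab assms(4)]
    by (simp add: partition_function_eq_boltzmann finite_multigraph_delete_edge assms(1)
      finite_multigraph_contract_edge[OF assms] states_delete_edge)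
qed

text \<open>Induction along a run of the recursion matches each rule with one of the three
  identities for the partition function. The weights \<open>z\<close> vary in the induction because
  contraction changes them, while \<open>J\<close> stays fixed because edges keep their
  names.\<close>

lemma V_rec_imp_partition_function:
  assumes "V_rec G z p" "finite_multigraph G" "q \<ge> 1"
  shows "partition_function q \<beta> G J z =
    eval_mpoly (case_V_indet (\<lambda>k. exp (\<beta> * k) + of_nat q - 1) (\<lambda>e. exp (\<beta> * J e) - 1)) p"
  using assms
proof (induction rule: V_rec.induct)
  case (isolated G z)
  then show ?case
    by (simp add: partition_function_isolated eval_mpoly_prod eval_mpoly_indet)
next
  case (loop e G z p)
  then show ?case
    by (simp add: partition_function_loop[of G e] finite_multigraph_delete_edge eval_mpoly_mult
      eval_mpoly_add eval_mpoly_one eval_mpoly_indet)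
next
  case (nonloop e G a b z p r)
  then show ?case
    by (simp add: partition_function_nonloop[of G e a b] finite_multigraph_delete_edge
      finite_multigraph_contract_edge eval_mpoly_mult eval_mpoly_add eval_mpoly_indet)
qed

theorem theorem5p4:
  fixes q :: nat and \<beta> :: complex
    and G :: "('v, 'e) multigraph"
    and J :: "'e \<Rightarrow> complex" and z :: "'v \<Rightarrow> complex"
  assumes "q \<ge> 1"
    and "finite_multigraph G"
  shows "partition_function q \<beta> G J z =
    V_value G z (\<lambda>k. exp (\<beta> * k) + of_nat q - 1) (\<lambda>e. exp (\<beta> * J e) - 1)"
  unfolding V_value_def
  by (rule V_rec_imp_partition_function[OF V_rec_V_poly[OF assms(2)] assms(2,1)])

end
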